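(* Let $n\ge 2$, let $a_1,\dots,a_n\in\mathbb{C}$, let $R=\mathbb{Z}[a_1,\dots,a_n]\subseteq\mathbb{C}$, let $p(x)=x^n-a_1x^{n-1}-\cdots-a_{n-1}x-a_n$, and consider the universal $sl(n)$ Frobenius extension $R\hookrightarrow A=R[x]/(p(x))$ with its genus-reduction term $g\in A$. If every (complex) root of $p(x)$ is repeated, then $g^i=0$ in $A$ for all $i\ge 2$. Otherwise, $g^i\neq 0$ in $A$ for all $i\ge 2$.
   Context: The universal $sl(n)$ Frobenius extension is $R\hookrightarrow A=R[x]/(p(x))$ together with the $R$-linear Frobenius form $\varepsilon:A\to R$ given on the basis $\{1,x,\dots,x^{n-1}\}$ by $\varepsilon(x^k)=0$ for $0\le k\le n-2$ and $\varepsilon(x^{n-1})=1$. A dual basis for it is the collection of pairs $(x_k,y_k)=(x^{n-1-k},\,x^k-a_1x^{k-1}-\cdots-a_k)$, $0\le k\le n-1$, which satisfy $a=\sum_k x_k\varepsilon(y_ka)=\sum_k\varepsilon(ax_k)y_k$ for all $a\in A$. The genus-reduction term is $g=\sum_k x_ky_k\in A$; explicitly $g=nx^{n-1}-(n-1)a_1x^{n-2}-(n-2)a_2x^{n-3}-\cdots-a_{n-1}$. A root is repeated if its multiplicity is at least $2$. The case of indeterminate $a_i$, or of $a_i$ subject to relations, is covered by choosing suitable complex numbers $a_i$. *)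

theory Defs
  imports
    "HOL-Algebra.UnivPoly"
    "HOL-Algebra.QuotRing"
    "HOL-Algebra.Generated_Rings"
    "HOL-Algebra.Algebraic_Closure_Type"
begin

text \<open>
  The coefficients \<open>a\<^sub>1, \<dots>, a\<^sub>n\<close> are the values \<open>a 1, \<dots>, a n\<close> of a function
  \<open>a :: nat \<Rightarrow> complex\<close>; no other value of \<open>a\<close> is used.
\<close>

definition sln_base :: "nat \<Rightarrow> (nat \<Rightarrow> complex) \<Rightarrow> complex ring"
  where "sln_base n a =
    ring_of_type_algebra\<lparr>carrier := generate_ring ring_of_type_algebra (a ` {1..n})\<rparr>"

definition sln_poly_ring :: "nat \<Rightarrow> (nat \<Rightarrow> complex) \<Rightarrow> (complex, nat \<Rightarrow> complex) up_ring"
  where "sln_poly_ring n a = UP (sln_base n a)"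

text \<open>
  The polynomial \<open>p\<close> occurs twice: over \<open>\<complex>\<close>, where its roots and their multiplicities are
  taken, and as an element of \<open>R[x]\<close>. Lemma \<open>sln_poly_UP_eq\<close> below shows that the two
  have the same coefficients.
\<close>

definition sln_poly :: "nat \<Rightarrow> (nat \<Rightarrow> complex) \<Rightarrow> complex poly"
  where "sln_poly n a = Polynomial.monom 1 n - (\<Sum>k=1..n. Polynomial.monom (a k) (n - k))"

definition sln_poly_UP :: "nat \<Rightarrow> (nat \<Rightarrow> complex) \<Rightarrow> (nat \<Rightarrow> complex)"
  where "sln_poly_UP n a =
    up_ring.monom (sln_poly_ring n a) 1 n \<ominus>\<^bsub>sln_poly_ring n a\<^esub>
      (\<Oplus>\<^bsub>sln_poly_ring n a\<^esub>k\<in>{1..n}. up_ring.monom (sln_poly_ring n a) (a k) (n - k))"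

definition sln_ideal :: "nat \<Rightarrow> (nat \<Rightarrow> complex) \<Rightarrow> (nat \<Rightarrow> complex) set"
  where "sln_ideal n a = PIdl\<^bsub>sln_poly_ring n a\<^esub> (sln_poly_UP n a)"

definition sln_algebra :: "nat \<Rightarrow> (nat \<Rightarrow> complex) \<Rightarrow> (nat \<Rightarrow> complex) set ring"
  where "sln_algebra n a = sln_poly_ring n a Quot sln_ideal n a"

definition sln_class :: "nat \<Rightarrow> (nat \<Rightarrow> complex) \<Rightarrow> (nat \<Rightarrow> complex) \<Rightarrow> (nat \<Rightarrow> complex) set"
  where "sln_class n a q = sln_ideal n a +>\<^bsub>sln_poly_ring n a\<^esub> q"

definition sln_scalar :: "nat \<Rightarrow> (nat \<Rightarrow> complex) \<Rightarrow> complex \<Rightarrow> (nat \<Rightarrow> complex) set"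
  where "sln_scalar n a r = sln_class n a (up_ring.monom (sln_poly_ring n a) r 0)"

definition sln_x :: "nat \<Rightarrow> (nat \<Rightarrow> complex) \<Rightarrow> (nat \<Rightarrow> complex) set"
  where "sln_x n a = sln_class n a (up_ring.monom (sln_poly_ring n a) 1 1)"

text \<open>
  The pairs \<open>(x\<^sub>k, y\<^sub>k)\<close>, \<open>0 \<le> k \<le> n - 1\<close>, form the dual basis with respect to the Frobenius
  form \<open>\<epsilon>\<close> that sends \<open>x\<^bsup>n-1\<^esup>\<close> to 1 and \<open>1, x, \<dots>, x\<^bsup>n-2\<^esup>\<close> to 0.
\<close>

definition sln_dual_x :: "nat \<Rightarrow> (nat \<Rightarrow> complex) \<Rightarrow> nat \<Rightarrow> (nat \<Rightarrow> complex) set"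
  where "sln_dual_x n a k = sln_x n a [^]\<^bsub>sln_algebra n a\<^esub> (n - 1 - k)"

definition sln_dual_y :: "nat \<Rightarrow> (nat \<Rightarrow> complex) \<Rightarrow> nat \<Rightarrow> (nat \<Rightarrow> complex) set"
  where "sln_dual_y n a k =
    sln_x n a [^]\<^bsub>sln_algebra n a\<^esub> k \<ominus>\<^bsub>sln_algebra n a\<^esub>
      (\<Oplus>\<^bsub>sln_algebra n a\<^esub>j\<in>{1..k}.
        sln_scalar n a (a j) \<otimes>\<^bsub>sln_algebra n a\<^esub> sln_x n a [^]\<^bsub>sln_algebra n a\<^esub> (k - j))"

definition genus_reduction :: "nat \<Rightarrow> (nat \<Rightarrow> complex) \<Rightarrow> (nat \<Rightarrow> complex) set"
  where "genus_reduction n a =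
    (\<Oplus>\<^bsub>sln_algebra n a\<^esub>k\<in>{0..n - 1}. sln_dual_x n a k \<otimes>\<^bsub>sln_algebra n a\<^esub> sln_dual_y n a k)"

lemma cring_sln_base: "cring (sln_base n a)"
proof -
  interpret C: cring "ring_of_type_algebra :: complex ring"
    by (rule cring_from_type_algebra)
  have sub: "subring (generate_ring ring_of_type_algebra (a ` {1..n}))
               (ring_of_type_algebra :: complex ring)"
    by (rule C.generate_ring_is_subring) (simp add: ring_of_type_algebra_def)
  show ?thesis
    unfolding sln_base_def
    using C.subcringI'[OF sub] C.subcring_iff[OF C.generate_ring_incl]
    by (simp add: ring_of_type_algebra_def)
qed

lemma sln_base_simps [simp]:
  "\<zero>\<^bsub>sln_base n a\<^esub> = 0" "\<one>\<^bsub>sln_base n a\<^esub> = 1"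
  "x \<oplus>\<^bsub>sln_base n a\<^esub> y = x + y" "x \<otimes>\<^bsub>sln_base n a\<^esub> y = x * y"
  by (simp_all add: sln_base_def ring_of_type_algebra_def)

lemma coeff_mem_sln_base: "k \<in> {1..n} \<Longrightarrow> a k \<in> carrier (sln_base n a)"
  by (auto simp: sln_base_def intro: generate_ring.incl)

lemma sln_poly_UP_closed: "sln_poly_UP n a \<in> carrier (sln_poly_ring n a)"
proof -
  interpret R: cring "sln_base n a" by (rule cring_sln_base)
  interpret UP_cring "sln_base n a" "sln_poly_ring n a"
    by unfold_locales (simp add: sln_poly_ring_def)
  have "up_ring.monom (sln_poly_ring n a) 1 n \<in> carrier (sln_poly_ring n a)"
    using monom_closed[OF R.one_closed] by simp
  moreover have "(\<Oplus>\<^bsub>sln_poly_ring n a\<^esub>k\<in>{1..n}. up_ring.monom (sln_poly_ring n a) (a k) (n - k))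
      \<in> carrier (sln_poly_ring n a)"
    by (rule P.finsum_closed) (auto intro!: monom_closed coeff_mem_sln_base)
  ultimately show ?thesis unfolding sln_poly_UP_def by simp
qed

lemma cring_sln_algebra: "cring (sln_algebra n a)"
proof -
  interpret R: cring "sln_base n a" by (rule cring_sln_base)
  interpret UP_cring "sln_base n a" "sln_poly_ring n a"
    by unfold_locales (simp add: sln_poly_ring_def)
  show ?thesis unfolding sln_algebra_def sln_ideal_def
    by (intro ideal.quotient_is_cring P.cgenideal_ideal sln_poly_UP_closed P.is_cring)
qed

lemma sln_base_finsum:
  assumes "finite S" "f \<in> S \<rightarrow> carrier (sln_base n a)"
  shows "finsum (sln_base n a) f S = sum f S"
proof -
  interpret R: cring "sln_base n a" by (rule cring_sln_base)
  show ?thesis using assms by (induction S rule: finite_induct) auto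
qed

lemma sln_base_uminus:
  assumes "x \<in> carrier (sln_base n a)"
  shows "\<ominus>\<^bsub>sln_base n a\<^esub> x = - x"
proof -
  interpret R: cring "sln_base n a" by (rule cring_sln_base)
  have "x + (\<ominus>\<^bsub>sln_base n a\<^esub> x) = 0" using R.r_neg[OF assms] by simp
  then show ?thesis by (metis add_eq_0_iff)
qed

lemma sln_poly_UP_eq: "sln_poly_UP n a = Polynomial.coeff (sln_poly n a)"
proof
  fix i
  interpret R: cring "sln_base n a" by (rule cring_sln_base)
  interpret UP_cring "sln_base n a" "sln_poly_ring n a"
    by unfold_locales (simp add: sln_poly_ring_def)
  let ?c = "up_ring.coeff (sln_poly_ring n a)" and ?m = "up_ring.monom (sln_poly_ring n a)"
  have m1: "?m 1 n \<in> carrier (sln_poly_ring n a)"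
    using monom_closed[OF R.one_closed] by simp
  have mk: "(\<lambda>k. ?m (a k) (n - k)) \<in> {1..n} \<rightarrow> carrier (sln_poly_ring n a)"
    by (auto intro!: monom_closed coeff_mem_sln_base)
  have one: "1 \<in> carrier (sln_base n a)" using R.one_closed by simp
  have cm: "?c (?m (a k) (n - k)) i = (if n - k = i then a k else 0)" if "k \<in> {1..n}" for k
    using coeff_monom[OF coeff_mem_sln_base[of k n a], of "n - k" i] that by simp
  have "sln_poly_UP n a i = ?c (sln_poly_UP n a) i"
    using sln_poly_UP_closed[of n a] unfolding UP_def sln_poly_ring_def by simp
  also have "\<dots> = ?c (?m 1 n) i \<ominus>\<^bsub>sln_base n a\<^esub>
      (\<Oplus>\<^bsub>sln_base n a\<^esub>k\<in>{1..n}. ?c (?m (a k) (n - k)) i)"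
    unfolding sln_poly_UP_def
    by (subst coeff_minus[OF m1 P.finsum_closed[OF mk]], subst coeff_finsum[OF _ mk]) simp_all
  also have "\<dots> = ?c (?m 1 n) i - (\<Sum>k=1..n. ?c (?m (a k) (n - k)) i)"
  proof -
    have *: "(\<lambda>k. ?c (?m (a k) (n - k)) i) \<in> {1..n} \<rightarrow> carrier (sln_base n a)"
      using mk by (auto intro!: coeff_closed)
    show ?thesis
      using sln_base_uminus[OF R.finsum_closed[OF *]] sln_base_finsum[OF finite_atLeastAtMost *]
      unfolding a_minus_def by simp
  qed
  also have "?c (?m 1 n) i = (if n = i then 1 else 0)"
    using coeff_monom[OF one, of n i] by simp
  also have "(\<Sum>k=1..n. ?c (?m (a k) (n - k)) i) = (\<Sum>k=1..n. if n - k = i then a k else 0)"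
    by (rule sum.cong[OF refl]) (rule cm)
  finally show "sln_poly_UP n a i = Polynomial.coeff (sln_poly n a) i"
    by (simp add: sln_poly_def coeff_sum)
qed

end

theory Submission
  imports Defs "HOL-Computational_Algebra.Fundamental_Theorem_Algebra"
begin

text \<open>
  The sum \<open>\<Sum>\<^sub>k x\<^sub>k y\<^sub>k\<close> collapses to \<open>p'(x)\<close>, so \<open>g\<^sup>i = 0\<close> says that \<open>p\<close> divides \<open>(p')\<^sup>i\<close> in
  \<open>R[x]\<close>. Because \<open>p\<close> is monic, this is the same as divisibility in \<open>\<complex>[x]\<close>, which can be read
  off the orders at the roots: a root of order \<open>m\<close> of \<open>p\<close> has order \<open>i(m - 1)\<close> in \<open>(p')\<^sup>i\<close>.
  For \<open>i \<ge> 2\<close> the inequality \<open>m \<le> i(m - 1)\<close> holds iff \<open>m \<ge> 2\<close>.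
\<close>

section \<open>Divisibility of complex polynomials and orders of roots\<close>

text \<open>Over an algebraically closed field a nonconstant \<open>p\<close> has a root, so linear
  factors can be split off one at a time. The converse direction does this by induction on the
  degree of \<open>p\<close>, ending at a constant, which is a unit.\<close>

lemma complex_poly_dvd_iff_order_le:
  fixes p q :: "complex poly"
  assumes "p \<noteq> 0" "q \<noteq> 0"
  shows "p dvd q \<longleftrightarrow> (\<forall>z. Polynomial.order z p \<le> Polynomial.order z q)"
proof
  show "p dvd q \<Longrightarrow> \<forall>z. Polynomial.order z p \<le> Polynomial.order z q"
    using assms dvd_imp_order_le by blast
next
  show "\<forall>z. Polynomial.order z p \<le> Polynomial.order z q \<Longrightarrow> p dvd q"
    using assms
  proof (induction "degree p" arbitrary: p q rule: less_induct)
    case less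
    show ?case
    proof (cases "degree p = 0")
      case True
      then show ?thesis using less.prems by (metis is_unit_iff_degree unit_imp_dvd)
    next
      case False
      then obtain z where z: "poly p z = 0"
        using fundamental_theorem_of_algebra constant_degree by metis
      let ?l = "[:-z, 1:]"
      have "poly q z = 0" using z less.prems by (metis order_root le_zero_eq)
      then obtain p' q' where pq: "p = ?l * p'" "q = ?l * q'"
        using z by (meson poly_eq_0_iff_dvd dvdE)
      then have nz: "p' \<noteq> 0" "q' \<noteq> 0" using less.prems by auto
      have "degree p' < degree p"
        using degree_mult_eq[of ?l p'] nz unfolding pq(1) by (simp del: mult_pCons_left)
      \<comment> \<open>Orders are additive over products, and the common factor \<open>?l\<close>
        contributes the same amount on both sides, so it cancels.\<close>
      moreover have "\<forall>w. Polynomial.order w p' \<le> Polynomial.order w q'"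
        using less.prems unfolding pq by (simp add: order_mult del: mult_pCons_left)
      ultimately have "p' dvd q'" using less.hyps nz by blast
      then show ?thesis unfolding pq by (rule mult_dvd_mono[OF dvd_refl])
    qed
  qed
qed

lemma poly_dvd_pderiv_power_iff:
  fixes p :: "complex poly"
  assumes "degree p \<noteq> 0" "i \<ge> 2"
  shows "p dvd pderiv p ^ i \<longleftrightarrow> (\<forall>z. poly p z = 0 \<longrightarrow> Polynomial.order z p \<ge> 2)"
proof -
  have p: "p \<noteq> 0" and dp: "pderiv p \<noteq> 0" using assms by (auto simp: pderiv_eq_0_iff)
  have ord: "Polynomial.order z (q ^ k) = k * Polynomial.order z q" if "q \<noteq> 0"
    for z k and q :: "complex poly"
    using that by (induction k) (auto simp: order_mult)
  have "Polynomial.order z p \<le> i * Polynomial.order z (pderiv p) \<longleftrightarrow>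
      (poly p z = 0 \<longrightarrow> Polynomial.order z p \<ge> 2)" for z
  proof (cases "poly p z = 0")
    case True
    define m where "m = Polynomial.order z (pderiv p)"
    have "Polynomial.order z p = Suc m" using order_pderiv[OF p True] by (simp add: m_def)
    \<comment> \<open>This is where \<open>i \<ge> 2\<close> enters:
      \<open>i * m \<ge> 2 * m \<ge> Suc m\<close>. At a simple root \<open>m = 0\<close>, and the
      inequality fails for every \<open>i\<close>.\<close>
    moreover have "Suc m \<le> i * m" if "m \<ge> 1"
      using mult_le_mono1[OF assms(2), of m] that by linarith
    ultimately show ?thesis using True by (cases m) (auto simp: m_def)
  next
    case False
    then show ?thesis using p by (simp add: order_root)
  qed
  then show ?thesis
    using p dp by (simp add: complex_poly_dvd_iff_order_le ord)
qed

section \<open>Division by a monic polynomial over a subring\<close>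

text \<open>The coefficients of the quotient are recovered from the top down.\<close>

lemma monic_dvd_coeff_mem:
  fixes S :: "'b::comm_ring_1 set" and p q r :: "'b poly"
  assumes "0 \<in> S" and diff: "\<And>x y. x \<in> S \<Longrightarrow> y \<in> S \<Longrightarrow> x - y \<in> S"
    and mult: "\<And>x y. x \<in> S \<Longrightarrow> y \<in> S \<Longrightarrow> x * y \<in> S"
    and "lead_coeff p = 1" and p: "\<And>i. Polynomial.coeff p i \<in> S"
    and q: "\<And>i. Polynomial.coeff (p * r) i \<in> S"
  shows "Polynomial.coeff r i \<in> S"
proof (induction "degree r - i" arbitrary: i rule: less_induct)
  case less
  have sum_mem: "sum f B \<in> S" if "finite B" "\<And>x. x \<in> B \<Longrightarrow> f x \<in> S" for f and B :: "nat set"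
    using that
  proof (induction B rule: finite_induct)
    case (insert x B)
    \<comment> \<open>Closure of \<open>S\<close> is assumed for differences only, so the sum is
      written as a double difference.\<close>
    have "f x - (0 - sum f B) \<in> S" using insert assms(1) by (intro diff) auto
    then show ?case using insert by simp
  qed (use assms(1) in simp)
  show ?case
  proof (cases "i > degree r")
    case True
    then show ?thesis using assms(1) by (simp add: coeff_eq_0)
  next
    case False
    let ?d = "degree p"
    let ?f = "\<lambda>j. Polynomial.coeff p j * Polynomial.coeff r (?d + i - j)"
    have mem: "Polynomial.coeff r j \<in> S" if "j > i" for j
    proof (cases "j > degree r")
      case True
      then show ?thesis using assms(1) by (simp add: coeff_eq_0)
    next
      case j: False
      then show ?thesis using less[of j] that by simp
    qed
    \<comment> \<open>At index \<open>?d + i\<close> the leading coefficient 1 of \<open>p\<close>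
      meets \<open>coeff r i\<close>. The terms with \<open>j < ?d\<close> involve only coefficients
      of \<open>r\<close> above \<open>i\<close>, which are covered by the induction hypothesis, and
      those with \<open>j > ?d\<close> vanish.\<close>
    have "Polynomial.coeff (p * r) (?d + i) = sum ?f {..?d + i}"
      by (simp add: coeff_mult)
    also have "\<dots> = sum ?f {..?d}"
      by (rule sum.mono_neutral_right) (auto simp: coeff_eq_0)
    also have "\<dots> = sum ?f {..<?d} + Polynomial.coeff r i"
      using assms(4) by (simp add: lessThan_Suc_atMost[symmetric])
    finally have "Polynomial.coeff r i = Polynomial.coeff (p * r) (?d + i) - sum ?f {..<?d}"
      by simp
    moreover have "sum ?f {..<?d} \<in> S"
      by (rule sum_mem) (auto intro!: mult p mem)
    ultimately show ?thesis using diff q by metis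
  qed
qed

section \<open>The polynomial \<open>p\<close> and its derivative\<close>

lemma degree_sln_poly: "n > 0 \<Longrightarrow> degree (sln_poly n a) = n"
  and lead_coeff_sln_poly: "n > 0 \<Longrightarrow> lead_coeff (sln_poly n a) = 1"
proof -
  assume n: "n > 0"
  have c: "Polynomial.coeff (sln_poly n a) i = (if i = n then 1 else 0)" if "i \<ge> n" for i
  proof -
    have "(\<Sum>k=1..n. Polynomial.coeff (Polynomial.monom (a k) (n - k)) i) = 0"
      using that n by (intro sum.neutral) auto
    then show ?thesis using that by (simp add: sln_poly_def coeff_sum)
  qed
  show d: "degree (sln_poly n a) = n"
  proof (rule antisym)
    show "degree (sln_poly n a) \<le> n" by (rule degree_le) (use c in auto)
    show "n \<le> degree (sln_poly n a)" by (rule le_degree) (use c in simp)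
  qed
  show "lead_coeff (sln_poly n a) = 1" using c by (simp add: d)
qed

text \<open>The right-hand side is \<Sum> \<open>x\<^sub>k y\<^sub>k\<close> for the dual basis,
  lifted to polynomials. After multiplying out, the term \<open>a j\<close> times \<open>x\<close>
  to the power \<open>n - 1 - j\<close> occurs once for each \<open>k\<close> from \<open>j\<close>
  to \<open>n - 1\<close>, hence \<open>n - j\<close> times, which is its coefficient in the
  derivative.\<close>

lemma pderiv_sln_poly:
  assumes "n > 0"
  shows "pderiv (sln_poly n a) =
    (\<Sum>k\<in>{0..n-1}. Polynomial.monom 1 (n - 1 - k) *
      (Polynomial.monom 1 k - (\<Sum>j\<in>{1..k}. Polynomial.monom (a j) 0 * Polynomial.monom 1 (k - j))))"
    (is "_ = ?R")
proof -
  let ?m = "\<lambda>j. Polynomial.monom (a j) (n - 1 - j)"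
  have "?R = (\<Sum>k\<in>{0..n-1}. Polynomial.monom 1 (n - 1) - (\<Sum>j\<in>{1..k}. ?m j))"
  proof (rule sum.cong[OF refl])
    fix k assume "k \<in> {0..n-1}"
    \<comment> \<open>Subtraction on naturals is truncated; these identities need
      \<open>j \<le> k \<le> n - 1\<close>.\<close>
    then have "n - 1 - k + k = n - 1" "\<And>j. j \<in> {1..k} \<Longrightarrow> n - 1 - k + (k - j) = n - 1 - j" by auto
    then show "Polynomial.monom 1 (n - 1 - k) * (Polynomial.monom 1 k -
        (\<Sum>j\<in>{1..k}. Polynomial.monom (a j) 0 * Polynomial.monom 1 (k - j))) =
      Polynomial.monom 1 (n - 1) - (\<Sum>j\<in>{1..k}. ?m j)"
      by (simp add: right_diff_distrib sum_distrib_left mult_monom)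
  qed
  also have "\<dots> = of_nat n * Polynomial.monom 1 (n - 1) - (\<Sum>k\<in>{0..n-1}. \<Sum>j\<in>{1..k}. ?m j)"
    using assms by (simp add: sum_subtractf)
  \<comment> \<open>The inner range becomes a restriction of the fixed range \<open>{1..n}\<close>,
    so that the sums can be swapped. The index \<open>j = n\<close> then gets no \<open>k\<close>,
    in accordance with the constant term of \<open>p\<close> having derivative 0.\<close>
  also have "(\<Sum>k\<in>{0..n-1}. \<Sum>j\<in>{1..k}. ?m j) = (\<Sum>k\<in>{0..n-1}. \<Sum>j\<in>{j\<in>{1..n}. j \<le> k}. ?m j)"
    using assms by (intro sum.cong) auto
  also have "\<dots> = (\<Sum>j\<in>{1..n}. \<Sum>k\<in>{k\<in>{0..n-1}. j \<le> k}. ?m j)"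
    by (rule sum.swap_restrict) auto
  also have "\<dots> = (\<Sum>j\<in>{1..n}. of_nat (n - j) * ?m j)"
  proof (rule sum.cong[OF refl])
    fix j assume "j \<in> {1..n}"
    then have "{k\<in>{0..n-1}. j \<le> k} = {j..<n}" by auto
    then show "(\<Sum>k\<in>{k\<in>{0..n-1}. j \<le> k}. ?m j) = of_nat (n - j) * ?m j" by simp
  qed
  finally show ?thesis
    by (simp add: sln_poly_def pderiv_diff higher_pderiv_sum[of 1, simplified] pderiv_monom of_nat_monom mult_monom)
qed

section \<open>The ring R[x] inside the complex polynomials and its map to A\<close>

text \<open>A copy of R[x] inside the type of complex polynomials, so that \<open>dvd\<close>,
  \<open>pderiv\<close> and \<open>order\<close> are available for its elements.\<close>

definition sln_base_polys :: "nat \<Rightarrow> (nat \<Rightarrow> complex) \<Rightarrow> complex poly set"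
  where "sln_base_polys n a = {q. \<forall>i. Polynomial.coeff q i \<in> carrier (sln_base n a)}"

definition sln_poly_class :: "nat \<Rightarrow> (nat \<Rightarrow> complex) \<Rightarrow> complex poly \<Rightarrow> (nat \<Rightarrow> complex) set"
  where "sln_poly_class n a q = sln_class n a (Polynomial.coeff q)"

lemma sln_poly_ring_ops:
  assumes "f \<in> carrier (sln_poly_ring n a)" "g \<in> carrier (sln_poly_ring n a)"
  shows "(f \<oplus>\<^bsub>sln_poly_ring n a\<^esub> g) i = f i + g i"
    "(f \<otimes>\<^bsub>sln_poly_ring n a\<^esub> g) i = (\<Oplus>\<^bsub>sln_base n a\<^esub>j\<in>{..i}. f j * g (i - j))"
  using assms by (simp_all add: sln_poly_ring_def UP_def)

context
  fixes n :: nat and a :: "nat \<Rightarrow> complex"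
begin

interpretation R: cring "sln_base n a" by (rule cring_sln_base)
interpretation UP_cring "sln_base n a" "sln_poly_ring n a"
  by unfold_locales (simp add: sln_poly_ring_def)
interpretation A: cring "sln_algebra n a" by (rule cring_sln_algebra)
interpretation I: ideal "sln_ideal n a" "sln_poly_ring n a"
  unfolding sln_ideal_def by (intro P.cgenideal_ideal sln_poly_UP_closed)

private abbreviation "B \<equiv> carrier (sln_base n a)"
private abbreviation "T \<equiv> sln_base_polys n a"
private abbreviation "h \<equiv> sln_poly_class n a"

lemma sln_base_closed:
  "0 \<in> B" "1 \<in> B" "x \<in> B \<Longrightarrow> y \<in> B \<Longrightarrow> x + y \<in> B" "x \<in> B \<Longrightarrow> y \<in> B \<Longrightarrow> x * y \<in> B"
  "x \<in> B \<Longrightarrow> y \<in> B \<Longrightarrow> x - y \<in> B"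
proof -
  show "x \<in> B \<Longrightarrow> y \<in> B \<Longrightarrow> x - y \<in> B"
    using R.minus_closed[of x y] sln_base_uminus[of y n a] by (simp add: a_minus_def)
qed (use R.zero_closed R.one_closed R.a_closed[of x y] R.m_closed[of x y] in simp_all)

lemma sln_base_sum_closed: "finite S \<Longrightarrow> (\<And>x. x \<in> S \<Longrightarrow> f x \<in> B) \<Longrightarrow> sum f S \<in> B"
  by (induction S rule: finite_induct) (auto intro: sln_base_closed)

lemma sln_base_polys_closed:
  "0 \<in> T" "1 \<in> T" "q \<in> T \<Longrightarrow> r \<in> T \<Longrightarrow> q + r \<in> T" "q \<in> T \<Longrightarrow> r \<in> T \<Longrightarrow> q * r \<in> T"
  "q \<in> T \<Longrightarrow> r \<in> T \<Longrightarrow> q - r \<in> T" "c \<in> B \<Longrightarrow> Polynomial.monom c k \<in> T"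
  by (auto simp: sln_base_polys_def Polynomial.coeff_mult intro!: sln_base_closed sln_base_sum_closed)

lemma sln_base_polys_sum_closed: "finite S \<Longrightarrow> (\<And>x. x \<in> S \<Longrightarrow> f x \<in> T) \<Longrightarrow> sum f S \<in> T"
  by (induction S rule: finite_induct) (auto intro: sln_base_polys_closed)

lemma sln_base_polys_power_closed: "q \<in> T \<Longrightarrow> q ^ k \<in> T"
  by (induction k) (auto intro: sln_base_polys_closed)

lemma sln_poly_mem: "sln_poly n a \<in> T"
  unfolding sln_poly_def
  by (intro sln_base_polys_closed sln_base_polys_sum_closed sln_base_closed)
     (auto intro: coeff_mem_sln_base)

text \<open>Both encodings of polynomials amount to finitely supported coefficient functions, so
  \<open>coeff\<close> translates between them without loss.\<close>

lemma coeff_image_sln_base_polys: "Polynomial.coeff ` T = carrier (sln_poly_ring n a)"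
proof (intro equalityI subsetI)
  fix f assume "f \<in> Polynomial.coeff ` T"
  then obtain q where q: "q \<in> T" "f = Polynomial.coeff q" by auto
  have "bound 0 (degree q) (Polynomial.coeff q)" by (auto intro!: bound.intro simp: coeff_eq_0)
  then show "f \<in> carrier (sln_poly_ring n a)"
    using q by (auto simp: sln_poly_ring_def UP_def sln_base_polys_def intro!: mem_upI exI)
next
  fix f assume "f \<in> carrier (sln_poly_ring n a)"
  then have f: "f \<in> up (sln_base n a)" by (simp add: sln_poly_ring_def UP_def)
  then obtain m where "bound 0 m f" by (auto simp: up_def)
  \<comment> \<open>The degree bound is turned into finite support, the condition under which
    \<open>Abs_poly\<close> inverts \<open>coeff\<close>.\<close>
  then have "\<forall>\<^sub>\<infinity> i. f i = 0"
    unfolding MOST_nat by (auto dest: bound.bound)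
  then have "Polynomial.coeff (Abs_poly f) = f" by (simp add: Abs_poly_inverse)
  then show "f \<in> Polynomial.coeff ` T"
    using mem_upD[OF f] by (auto simp: sln_base_polys_def intro!: image_eqI[where x = "Abs_poly f"])
qed

lemma coeff_mem_sln_poly_ring: "q \<in> T \<Longrightarrow> Polynomial.coeff q \<in> carrier (sln_poly_ring n a)"
  using coeff_image_sln_base_polys by blast

lemma coeff_mult_sln_poly_ring:
  assumes "q \<in> T" "r \<in> T"
  shows "Polynomial.coeff (q * r) = Polynomial.coeff q \<otimes>\<^bsub>sln_poly_ring n a\<^esub> Polynomial.coeff r"
proof
  fix i
  have "(\<Oplus>\<^bsub>sln_base n a\<^esub>j\<in>{..i}. Polynomial.coeff q j * Polynomial.coeff r (i - j)) =
      (\<Sum>j\<le>i. Polynomial.coeff q j * Polynomial.coeff r (i - j))"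
    using assms by (intro sln_base_finsum) (auto simp: sln_base_polys_def intro!: sln_base_closed)
  then show "Polynomial.coeff (q * r) i =
      (Polynomial.coeff q \<otimes>\<^bsub>sln_poly_ring n a\<^esub> Polynomial.coeff r) i"
    by (simp only: sln_poly_ring_ops(2)[OF assms[THEN coeff_mem_sln_poly_ring]]
        Polynomial.coeff_mult)
qed

text \<open>The coset map from R[x] to A is a ring homomorphism, and on \<open>T\<close> the
  operations of complex polynomials agree with those of R[x] through \<open>coeff\<close>.\<close>

lemma sln_poly_class_closed: "q \<in> T \<Longrightarrow> h q \<in> carrier (sln_algebra n a)"
  and sln_poly_class_one: "h 1 = \<one>\<^bsub>sln_algebra n a\<^esub>"
  and sln_poly_class_add: "q \<in> T \<Longrightarrow> r \<in> T \<Longrightarrow> h (q + r) = h q \<oplus>\<^bsub>sln_algebra n a\<^esub> h r"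
  and sln_poly_class_mult: "q \<in> T \<Longrightarrow> r \<in> T \<Longrightarrow> h (q * r) = h q \<otimes>\<^bsub>sln_algebra n a\<^esub> h r"
proof -
  have hom: "sln_class n a \<in> ring_hom (sln_poly_ring n a) (sln_algebra n a)"
    using I.rcos_ring_hom unfolding sln_class_def[abs_def] sln_algebra_def .
  show "q \<in> T \<Longrightarrow> h q \<in> carrier (sln_algebra n a)"
    unfolding sln_poly_class_def using ring_hom_closed[OF hom] coeff_mem_sln_poly_ring by blast
  have "Polynomial.coeff 1 = \<one>\<^bsub>sln_poly_ring n a\<^esub>"
    by (auto simp: sln_poly_ring_def UP_def fun_eq_iff)
  then show "h 1 = \<one>\<^bsub>sln_algebra n a\<^esub>"
    unfolding sln_poly_class_def using ring_hom_one[OF hom] by simp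
  assume qr: "q \<in> T" "r \<in> T"
  note mem = qr[THEN coeff_mem_sln_poly_ring]
  have "Polynomial.coeff (q + r) = Polynomial.coeff q \<oplus>\<^bsub>sln_poly_ring n a\<^esub> Polynomial.coeff r"
    by (rule ext) (simp only: sln_poly_ring_ops(1)[OF mem] Polynomial.coeff_add)
  then show "h (q + r) = h q \<oplus>\<^bsub>sln_algebra n a\<^esub> h r"
    unfolding sln_poly_class_def using ring_hom_add[OF hom mem] by simp
  show "h (q * r) = h q \<otimes>\<^bsub>sln_algebra n a\<^esub> h r"
    unfolding sln_poly_class_def coeff_mult_sln_poly_ring[OF qr] using ring_hom_mult[OF hom mem] .
qed

lemma sln_poly_class_zero: "h 0 = \<zero>\<^bsub>sln_algebra n a\<^esub>"
  using sln_poly_class_add[of 0 0] sln_poly_class_closed[of 0] sln_base_polys_closed(1)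
  by (metis A.add.r_cancel_one add_0)

lemma sln_poly_class_diff:
  assumes "q \<in> T" "r \<in> T"
  shows "h (q - r) = h q \<ominus>\<^bsub>sln_algebra n a\<^esub> h r"
proof -
  have "h q = h (q - r) \<oplus>\<^bsub>sln_algebra n a\<^esub> h r"
    using sln_poly_class_add[of "q - r" r] assms sln_base_polys_closed(5) by simp
  then show ?thesis
    using assms sln_base_polys_closed(5) sln_poly_class_closed
    by (simp add: a_minus_def A.a_assoc A.r_neg)
qed

lemma sln_poly_class_power: "q \<in> T \<Longrightarrow> h (q ^ k) = h q [^]\<^bsub>sln_algebra n a\<^esub> k"
  \<comment> \<open>Powers in HOL-Algebra grow by a factor on the right, hence
    \<open>power_Suc2\<close> in place of \<open>power_Suc\<close>.\<close>
  by (induction k)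
     (simp_all add: sln_poly_class_one sln_poly_class_mult sln_base_polys_power_closed
        power_Suc2 del: power_Suc)

lemma sln_poly_class_sum:
  assumes "finite S" "\<And>x. x \<in> S \<Longrightarrow> f x \<in> T"
  shows "h (sum f S) = (\<Oplus>\<^bsub>sln_algebra n a\<^esub>x\<in>S. h (f x))"
  using assms
proof (induction S rule: finite_induct)
  case (insert x S)
  have "(\<lambda>x. h (f x)) \<in> S \<rightarrow> carrier (sln_algebra n a)"
    using insert.prems sln_poly_class_closed by auto
  then show ?case
    using insert by (simp add: sln_poly_class_add sln_base_polys_sum_closed sln_poly_class_closed)
qed (simp add: sln_poly_class_zero)

lemma sln_poly_class_monom:
  "c \<in> B \<Longrightarrow> h (Polynomial.monom c k) = sln_class n a (up_ring.monom (sln_poly_ring n a) c k)"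
  unfolding sln_poly_class_def
  by (rule arg_cong[where f = "sln_class n a"])
     (auto simp: sln_poly_ring_def UP_def fun_eq_iff)

lemma sln_poly_class_monom_one:
  "h (Polynomial.monom 1 k) = sln_x n a [^]\<^bsub>sln_algebra n a\<^esub> k"
  using sln_poly_class_power[of "Polynomial.monom 1 1" k] sln_base_closed(2)
    sln_base_polys_closed(6)[of 1 1]
  by (simp add: sln_x_def sln_poly_class_monom monom_power)

text \<open>The kernel of the coset map consists of the multiples of \<open>p\<close> with cofactor
  in R[x]. As \<open>p\<close> is monic, a complex cofactor of an element of R[x] has its
  coefficients in R automatically, so divisibility may be tested over the complex numbers.\<close>

lemma sln_poly_class_eq_zero_iff:
  assumes "n > 0" "q \<in> T"
  shows "h q = \<zero>\<^bsub>sln_algebra n a\<^esub> \<longleftrightarrow> sln_poly n a dvd q"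
proof -
  have zero: "\<zero>\<^bsub>sln_algebra n a\<^esub> = sln_ideal n a" by (simp add: sln_algebra_def FactRing_def)
  have "h q = \<zero>\<^bsub>sln_algebra n a\<^esub> \<longleftrightarrow> Polynomial.coeff q \<in> sln_ideal n a"
    unfolding zero sln_poly_class_def sln_class_def
    using I.rcos_const_imp_mem I.a_rcos_const coeff_mem_sln_poly_ring[OF assms(2)] by blast
  also have "\<dots> \<longleftrightarrow> (\<exists>r\<in>T. Polynomial.coeff q =
      Polynomial.coeff r \<otimes>\<^bsub>sln_poly_ring n a\<^esub> Polynomial.coeff (sln_poly n a))"
    unfolding sln_ideal_def cgenideal_def sln_poly_UP_eq coeff_image_sln_base_polys[symmetric]
    by blast
  also have "\<dots> \<longleftrightarrow> (\<exists>r\<in>T. q = r * sln_poly n a)"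
    by (rule bex_cong[OF refl])
       (simp only: coeff_mult_sln_poly_ring[OF _ sln_poly_mem, symmetric] coeff_inject)
  also have "\<dots> \<longleftrightarrow> sln_poly n a dvd q"
  proof
    assume "sln_poly n a dvd q"
    then obtain r where r: "q = sln_poly n a * r" by auto
    have "Polynomial.coeff r i \<in> B" for i
    proof (rule monic_dvd_coeff_mem[of B "sln_poly n a"])
      show "lead_coeff (sln_poly n a) = 1" using assms by (intro lead_coeff_sln_poly)
    qed (use sln_poly_mem assms r in \<open>auto simp: sln_base_polys_def intro: sln_base_closed\<close>)
    then show "\<exists>r\<in>T. q = r * sln_poly n a"
      by (intro bexI[of _ r]) (auto simp: r sln_base_polys_def)
  qed auto
  finally show ?thesis .
qed

section \<open>The genus-reduction term\<close>

text \<open>The polynomials \<open>?x k\<close> and \<open>?y k\<close> represent the dual basis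
  elements \<open>x\<^sub>k\<close> and \<open>y\<^sub>k\<close>. Since \<open>h\<close> respects
  sums and products on \<open>T\<close>, the computation of \<Sum>
  \<open>x\<^sub>k y\<^sub>k\<close> moves from A to polynomials, where
  \<open>pderiv_sln_poly\<close> evaluates it.\<close>

lemma genus_reduction_eq_pderiv:
  assumes "n > 0"
  shows "pderiv (sln_poly n a) \<in> T" "genus_reduction n a = h (pderiv (sln_poly n a))"
proof -
  let ?x = "\<lambda>k. Polynomial.monom 1 (n - 1 - k) :: complex poly"
  let ?s = "\<lambda>k. \<Sum>j\<in>{1..k}. Polynomial.monom (a j) 0 * Polynomial.monom 1 (k - j)"
  let ?y = "\<lambda>k. Polynomial.monom 1 k - ?s k"
  \<comment> \<open>The bounds \<open>1 \<le> j \<le> k \<le> n - 1\<close> keep \<open>a j\<close>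
    among the generators of R.\<close>
  have ax: "Polynomial.monom (a j) 0 * Polynomial.monom 1 (k - j) \<in> T"
    if "k \<in> {0..n-1}" "j \<in> {1..k}" for j k
    using that by (intro sln_base_polys_closed sln_base_closed coeff_mem_sln_base) auto
  have x: "Polynomial.monom 1 k \<in> T" for k
    by (intro sln_base_polys_closed sln_base_closed)
  have s: "?s k \<in> T" if "k \<in> {0..n-1}" for k
    using that by (intro sln_base_polys_sum_closed ax) auto
  have y: "?y k \<in> T" if "k \<in> {0..n-1}" for k
    using that s x by (intro sln_base_polys_closed(5)) auto
  have hs: "h (?s k) = (\<Oplus>\<^bsub>sln_algebra n a\<^esub>j\<in>{1..k}.
      sln_scalar n a (a j) \<otimes>\<^bsub>sln_algebra n a\<^esub> sln_x n a [^]\<^bsub>sln_algebra n a\<^esub> (k - j))"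
    if k: "k \<in> {0..n-1}" for k
  proof -
    have aj: "a j \<in> B" if "j \<in> {1..k}" for j using that k by (intro coeff_mem_sln_base) auto
    have e: "h (Polynomial.monom (a j) 0 * Polynomial.monom 1 (k - j)) =
        sln_scalar n a (a j) \<otimes>\<^bsub>sln_algebra n a\<^esub> sln_x n a [^]\<^bsub>sln_algebra n a\<^esub> (k - j)"
      if "j \<in> {1..k}" for j
      using aj[OF that] x sln_base_polys_closed(6)
      by (simp add: sln_poly_class_mult sln_scalar_def sln_poly_class_monom
          sln_poly_class_monom_one[symmetric] sln_base_closed(2))
    have "h (?s k) = (\<Oplus>\<^bsub>sln_algebra n a\<^esub>j\<in>{1..k}.
        h (Polynomial.monom (a j) 0 * Polynomial.monom 1 (k - j)))"
      using ax[OF k] by (intro sln_poly_class_sum) auto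
    also have "\<dots> = (\<Oplus>\<^bsub>sln_algebra n a\<^esub>j\<in>{1..k}.
      sln_scalar n a (a j) \<otimes>\<^bsub>sln_algebra n a\<^esub> sln_x n a [^]\<^bsub>sln_algebra n a\<^esub> (k - j))"
      using e sln_poly_class_closed[OF ax[OF k]] by (intro A.finsum_cong') auto
    finally show ?thesis .
  qed
  have hxy: "h (?x k * ?y k) = sln_dual_x n a k \<otimes>\<^bsub>sln_algebra n a\<^esub> sln_dual_y n a k"
    if "k \<in> {0..n-1}" for k
    unfolding sln_dual_x_def sln_dual_y_def
    by (simp only: sln_poly_class_mult[OF x y[OF that]] sln_poly_class_diff[OF x s[OF that]]
        hs[OF that] sln_poly_class_monom_one)
  have xy: "?x k * ?y k \<in> T" if "k \<in> {0..n-1}" for k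
    using that by (intro sln_base_polys_closed(4) x y)
  have d: "pderiv (sln_poly n a) = (\<Sum>k\<in>{0..n-1}. ?x k * ?y k)"
    by (rule pderiv_sln_poly[OF assms])
  show "pderiv (sln_poly n a) \<in> T"
    unfolding d by (intro sln_base_polys_sum_closed xy) auto
  have "h (pderiv (sln_poly n a)) = (\<Oplus>\<^bsub>sln_algebra n a\<^esub>k\<in>{0..n-1}. h (?x k * ?y k))"
    unfolding d by (intro sln_poly_class_sum xy) auto
  also have "\<dots> = genus_reduction n a"
    unfolding genus_reduction_def
    using hxy sln_poly_class_closed[OF xy] by (intro A.finsum_cong') auto
  finally show "genus_reduction n a = h (pderiv (sln_poly n a))" ..
qed

lemma genus_reduction_power_eq_zero_iff:
  assumes "n > 0"
  shows "genus_reduction n a [^]\<^bsub>sln_algebra n a\<^esub> (i::nat) = \<zero>\<^bsub>sln_algebra n a\<^esub> \<longleftrightarrow>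
    sln_poly n a dvd pderiv (sln_poly n a) ^ i"
  using genus_reduction_eq_pderiv[OF assms] assms
  by (simp add: sln_poly_class_power[symmetric] sln_poly_class_eq_zero_iff
      sln_base_polys_power_closed)

end

theorem corollary4p7:
  fixes n :: nat and a :: "nat \<Rightarrow> complex"
  assumes "n \<ge> 2"
  shows "((\<forall>z. poly (sln_poly n a) z = 0 \<longrightarrow> order z (sln_poly n a) \<ge> 2) \<longrightarrow>
           (\<forall>i::nat. i \<ge> 2 \<longrightarrow>
             genus_reduction n a [^]\<^bsub>sln_algebra n a\<^esub> i = \<zero>\<^bsub>sln_algebra n a\<^esub>)) \<and>
         (\<not> (\<forall>z. poly (sln_poly n a) z = 0 \<longrightarrow> order z (sln_poly n a) \<ge> 2) \<longrightarrow>
           (\<forall>i::nat. i \<ge> 2 \<longrightarrow>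
             genus_reduction n a [^]\<^bsub>sln_algebra n a\<^esub> i \<noteq> \<zero>\<^bsub>sln_algebra n a\<^esub>))"
proof -
  have "n > 0" "degree (sln_poly n a) \<noteq> 0" using assms by (simp_all add: degree_sln_poly)
  then show ?thesis
    by (simp add: genus_reduction_power_eq_zero_iff poly_dvd_pderiv_power_iff)
qed

end
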